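(* Let $(\mathbb X,d_{\mathbb X})$ be a totally bounded metric space with Borel $\sigma$-algebra $\mathscr X$, let $\gamma$ be a probability measure on $(\mathbb X\times\mathbb R^d,\mathscr X\otimes\mathscr B(\mathbb R^d))$ whose first marginal $\chi$ has support equal to $\mathbb X$, and let $\pi(\cdot|\cdot):\mathscr B(\mathbb R^d)\times\mathbb X\to[0,1]$ be a probability kernel with $\int_A\pi(B|x)\,\chi(dx)=\gamma(A\times B)$ for all $A\in\mathscr X$, $B\in\mathscr B(\mathbb R^d)$. Let $\epsilon>0$ and let $\{A_1,\dots,A_{k(\epsilon)}\}\subset\mathscr X$ be a finite partition of $\mathbb X$ into pairwise disjoint sets with $\chi(A_j)>0$, $\chi(\partial A_j)=0$ and $\mathrm{diam}(A_j)\le\epsilon$ for every $j$. Define $$\pi_\epsilon(B|x):=\sum_{j=1}^{k(\epsilon)}\frac{\gamma(A_j\times B)}{\chi(A_j)}\,\mathbf 1_{A_j}(x),\qquad B\in\mathscr B(\mathbb R^d),\ x\in\mathbb X.$$ Let $d_{\mathcal P(\mathbb R^d)}$ be any distance on the space $\mathcal P(\mathbb R^d)$ of probability measures on $(\mathbb R^d,\mathscr B(\mathbb R^d))$ which is convex and measurable as a map from $(\mathcal P(\mathbb R^d)^2,\mathscr P(\mathbb R^d)\otimes\mathscr P(\mathbb R^d))$ to $([0,+\infty),\mathscr B([0,+\infty)))$. If for some $L\ge0$ $$d_{\mathcal P(\mathbb R^d)}(\pi(\cdot|x_1),\pi(\cdot|x_2))\le L\,d_{\mathbb X}(x_1,x_2)\qquad\forall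 x_1,x_2\in\mathbb X,$$ then $$d_{\mathcal P(\mathbb R^d)}(\pi(\cdot|x),\pi_\epsilon(\cdot|x))\le L\epsilon\qquad\forall x\in\mathbb X.$$
   Context: $\mathscr B(\cdot)$ denotes the Borel $\sigma$-algebra. $\mathscr P(\mathbb R^d)$ is the Borel $\sigma$-algebra on $\mathcal P(\mathbb R^d)$ generated by the topology of weak convergence of probability measures. $\mathbf 1_{A}$ is the indicator function of $A$ and $\partial A$ the topological boundary of $A$.
   Formalization: "Convex" is taken as joint convexity for arbitrary probability mixtures (Jensen's inequality on pairs of measures), not just two-point mixtures; with two-point convexity and measurability alone the claim fails, e.g. when total atomic mass differences are added to a bounded Lipschitz metric. *)

theory Defs
  imports "HOL-Probability.Probability"
begin

definition prob_measures :: "'a::topological_space measure set" where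
  "prob_measures = {M. prob_space M \<and> sets M = sets borel}"

text \<open>The topology of weak convergence: the coarsest one making \<open>M \<mapsto> \<integral>f dM\<close> continuous for every
  bounded continuous real function \<open>f\<close>. Its underlying set is \<open>prob_measures\<close>.\<close>

definition weak_topology :: "'a::topological_space measure topology" where
  "weak_topology = topology_generated_by
     {{M \<in> prob_measures. (\<integral>x. f x \<partial>M) \<in> U} | (f :: 'a \<Rightarrow> real) U.
        continuous_on UNIV f \<and> bounded (range f) \<and> open U}"

definition weak_borel :: "'a::topological_space measure measure" where
  "weak_borel = sigma prob_measures {U. openin weak_topology U}"

text \<open>Convexity of a function \<open>d\<close> on pairs of probability measures, with respect to arbitrary (not
  only finite) mixtures: if \<open>(\<mu>, \<nu>)\<close> is the barycentre of a probability measure \<open>Q\<close> on pairs, then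
  \<open>d \<mu> \<nu> \<le> \<integral>d dQ\<close>. Finitely supported \<open>Q\<close> give back the usual two-point inequality, see
  \<open>mixture_convex_imp_convex\<close> below. For a function \<open>d\<close> that is merely measurable the two-point
  inequality does not imply the one for general \<open>Q\<close>. The value of \<open>d\<close> is nonnegative
  wherever this is used, so that \<open>ennreal\<close> does not truncate.\<close>

definition mixture_convex :: "('a::topological_space measure \<Rightarrow> 'a measure \<Rightarrow> real) \<Rightarrow> bool" where
  "mixture_convex d \<longleftrightarrow>
     (\<forall>Q \<mu> \<nu>. prob_space Q \<longrightarrow> sets Q = sets (weak_borel \<Otimes>\<^sub>M weak_borel) \<longrightarrow>
        \<mu> \<in> prob_measures \<longrightarrow> \<nu> \<in> prob_measures \<longrightarrow>
        (\<forall>B\<in>sets borel. emeasure \<mu> B = (\<integral>\<^sup>+p. emeasure (fst p) B \<partial>Q)) \<longrightarrow>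
        (\<forall>B\<in>sets borel. emeasure \<nu> B = (\<integral>\<^sup>+p. emeasure (snd p) B \<partial>Q)) \<longrightarrow>
        ennreal (d \<mu> \<nu>) \<le> (\<integral>\<^sup>+p. ennreal (d (fst p) (snd p)) \<partial>Q))"

definition first_marginal :: "('x::topological_space \<times> 'b) measure \<Rightarrow> 'x measure" where
  "first_marginal \<gamma> = distr \<gamma> borel fst"

definition measure_support :: "'x::topological_space measure \<Rightarrow> 'x set" where
  "measure_support M = {x. \<forall>U. open U \<longrightarrow> x \<in> U \<longrightarrow> emeasure M U > 0}"

definition averaged_kernel ::
  "('x::topological_space \<times> 'b::topological_space) measure \<Rightarrow> nat \<Rightarrow> (nat \<Rightarrow> 'x set) \<Rightarrow> 'x \<Rightarrow> 'b measure"
where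
  "averaged_kernel \<gamma> k A x = measure_of UNIV (sets borel)
     (\<lambda>B. ennreal (\<Sum>j=1..k. measure \<gamma> (A j \<times> B) / measure (first_marginal \<gamma>) (A j) * indicator (A j) x))"

lemma topspace_weak_topology: "topspace weak_topology = prob_measures"
proof -
  have "prob_measures \<in> {{M \<in> prob_measures. (\<integral>x. f x \<partial>M) \<in> U} | (f :: 'a \<Rightarrow> real) U.
        continuous_on UNIV f \<and> bounded (range f) \<and> open U}"
    by (intro CollectI exI[of _ "\<lambda>_. 0"] exI[of _ UNIV]) auto
  then show ?thesis
    unfolding weak_topology_def topology_generated_by_topspace by blast
qed

lemma weak_borel_openin: "{U. openin weak_topology U} \<subseteq> Pow prob_measures"
  using openin_subset topspace_weak_topology by blast

lemma space_weak_borel [simp]: "space weak_borel = prob_measures"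
  unfolding weak_borel_def using weak_borel_openin by (rule space_measure_of)

lemma measurable_integral_weak_borel:
  fixes f :: "'a::topological_space \<Rightarrow> real"
  assumes "continuous_on UNIV f" "bounded (range f)"
  shows "(\<lambda>M. \<integral>x. f x \<partial>M) \<in> borel_measurable weak_borel"
proof (rule borel_measurableI)
  fix U :: "real set" assume "open U"
  have "openin weak_topology {M \<in> prob_measures. (\<integral>x. f x \<partial>M) \<in> U}"
    unfolding weak_topology_def
    by (rule topology_generated_by_Basis) (use assms \<open>open U\<close> in blast)
  then have "{M \<in> prob_measures. (\<integral>x. f x \<partial>M) \<in> U} \<in> sets weak_borel"
    unfolding weak_borel_def sets_measure_of[OF weak_borel_openin] by (simp add: sigma_sets.Basic)
  also have "{M \<in> prob_measures. (\<integral>x. f x \<partial>M) \<in> U} = (\<lambda>M. \<integral>x. f x \<partial>M) -` U \<inter> space weak_borel"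
    by auto
  finally show "(\<lambda>M. \<integral>x. f x \<partial>M) -` U \<inter> space weak_borel \<in> sets weak_borel" .
qed

lemma measurable_measure_weak_borel:
  fixes B :: "'a::metric_space set"
  assumes "B \<in> sets borel"
  shows "(\<lambda>M. measure M B) \<in> borel_measurable weak_borel"
proof -
  have pm: "prob_space M" "sets M = sets borel" "space M = UNIV"
    if "M \<in> space weak_borel" for M :: "'a measure"
    using that sets_eq_imp_space_eq[of M borel] by (auto simp: prob_measures_def)
  have gen: "sets (borel :: 'a measure) = sigma_sets UNIV (Collect closed)"
    by (simp add: borel_eq_closed)
  have st: "Int_stable (Collect closed :: 'a set set)"
    by (auto simp: Int_stable_def)
  have subset_Pow: "Collect closed \<subseteq> Pow (UNIV :: 'a set)"
    by simp
  have "B \<in> sigma_sets UNIV (Collect closed)"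
    using assms gen by simp
  with st subset_Pow show ?thesis
  proof (induction rule: sigma_sets_induct_disjoint)
    case (basic C)
    show ?case
    proof (cases "C = {}")
      case False
      define f where "f n x = max 0 (1 - real n * infdist x C)" for n x
      have cont: "continuous_on UNIV (f n)" for n
        unfolding f_def by (intro continuous_intros)
      have f01: "0 \<le> f n x" "f n x \<le> 1" for n x
        by (auto simp: f_def infdist_nonneg)
      then have bd: "bounded (range (f n))" for n
        by (intro boundedI[of _ 1]) auto
      have lim: "(\<lambda>n. f n x) \<longlonglongrightarrow> indicator C x" for x
      proof (cases "x \<in> C")
        case True
        then have "f n x = 1" for n by (simp add: f_def)
        with True show ?thesis by simp
      next
        case x: False
        then have pos: "infdist x C > 0"
          using basic False in_closed_iff_infdist_zero[of C x] infdist_nonneg[of x C]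
          by (simp add: order_less_le)
        then obtain N where N: "1 < real N * infdist x C"
          using reals_Archimedean3 by blast
        have "f n x = 0" if "n \<ge> N" for n
        proof -
          have "real N * infdist x C \<le> real n * infdist x C"
            using that pos by (intro mult_right_mono) auto
          with N show ?thesis by (simp add: f_def)
        qed
        then have "eventually (\<lambda>n. f n x = 0) sequentially"
          using eventually_sequentially by blast
        then have "(\<lambda>n. f n x) \<longlonglongrightarrow> 0"
          by (rule tendsto_eventually)
        with x show ?thesis by simp
      qed
      show ?thesis
      proof (rule borel_measurable_LIMSEQ_real)
        show "(\<lambda>M. \<integral>x. f n x \<partial>M) \<in> borel_measurable weak_borel" for n
          by (rule measurable_integral_weak_borel[OF cont bd])
        fix M :: "'a measure" assume "M \<in> space weak_borel"
        note M = pm[OF this]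
        interpret prob_space M by (rule M)
        have "C \<in> sets M" using basic M by auto
        have "(\<lambda>n. \<integral>x. f n x \<partial>M) \<longlonglongrightarrow> (\<integral>x. indicator C x \<partial>M)"
        proof (rule integral_dominated_convergence[where w = "\<lambda>_. 1"])
          show "f n \<in> borel_measurable M" for n
            using borel_measurable_continuous_onI[OF cont] measurable_cong_sets[OF M(2) refl] by blast
        qed (use lim f01 M \<open>C \<in> sets M\<close> in auto)
        then show "(\<lambda>n. \<integral>x. f n x \<partial>M) \<longlonglongrightarrow> measure M C"
          using \<open>C \<in> sets M\<close> by simp
      qed
    qed simp
  next
    case empty
    show ?case by simp
  next
    case (compl A)
    have "(\<lambda>M. 1 - measure M A) \<in> borel_measurable weak_borel"
      using compl.IH by simp
    moreover have "measure M (UNIV - A) = 1 - measure M A" if "M \<in> space weak_borel" for M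
      using prob_space.prob_compl[OF pm(1)[OF that], of A] pm[OF that] compl.hyps gen by simp
    ultimately show ?case
      using measurable_cong[of weak_borel "\<lambda>M. measure M (UNIV - A)" "\<lambda>M. 1 - measure M A"] by blast
  next
    case (union A)
    have "(\<lambda>M. \<Sum>n. measure M (A n)) \<in> borel_measurable weak_borel"
      using union.IH by (intro borel_measurable_suminf)
    moreover have "measure M (\<Union>(range A)) = (\<Sum>n. measure M (A n))" if "M \<in> space weak_borel" for M
    proof -
      interpret prob_space M by (rule pm(1)[OF that])
      show ?thesis
        using pm[OF that] union.hyps gen by (intro finite_measure_UNION[THEN sums_unique]) auto
    qed
    ultimately show ?case
      using measurable_cong[of weak_borel "\<lambda>M. measure M (\<Union>(range A))"
          "\<lambda>M. \<Sum>n. measure M (A n)"] by blast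
  qed
qed

lemma mixture_convex_imp_convex:
  fixes d :: "'a::metric_space measure \<Rightarrow> 'a measure \<Rightarrow> real"
  assumes conv: "mixture_convex d"
    and meas: "(\<lambda>p. d (fst p) (snd p)) \<in> borel_measurable (weak_borel \<Otimes>\<^sub>M weak_borel)"
    and nonneg: "\<And>\<mu> \<nu>. 0 \<le> d \<mu> \<nu>"
    and t: "0 \<le> t" "t \<le> 1"
    and in_P: "\<mu> \<in> prob_measures" "\<mu>1 \<in> prob_measures" "\<mu>2 \<in> prob_measures"
      "\<nu> \<in> prob_measures" "\<nu>1 \<in> prob_measures" "\<nu>2 \<in> prob_measures"
    and \<mu>: "\<And>B. B \<in> sets borel \<Longrightarrow> measure \<mu> B = t * measure \<mu>1 B + (1 - t) * measure \<mu>2 B"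
    and \<nu>: "\<And>B. B \<in> sets borel \<Longrightarrow> measure \<nu> B = t * measure \<nu>1 B + (1 - t) * measure \<nu>2 B"
  shows "d \<mu> \<nu> \<le> t * d \<mu>1 \<nu>1 + (1 - t) * d \<mu>2 \<nu>2"
proof -
  let ?P = "weak_borel \<Otimes>\<^sub>M weak_borel :: ('a measure \<times> 'a measure) measure"
  let ?b = "measure_pmf (bernoulli_pmf t)"
  define g where "g b = (if b then (\<mu>1, \<nu>1) else (\<mu>2, \<nu>2))" for b
  have g: "g \<in> ?b \<rightarrow>\<^sub>M ?P"
    using in_P by (auto simp: g_def space_pair_measure)
  define Q where "Q = distr ?b ?P g"
  have Q: "prob_space Q" "sets Q = sets ?P"
    unfolding Q_def using measure_pmf.prob_space_distr[OF g] by auto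
  have int: "(\<integral>\<^sup>+p. ennreal (h p) \<partial>Q) = ennreal (t * h (\<mu>1, \<nu>1) + (1 - t) * h (\<mu>2, \<nu>2))"
    if "h \<in> borel_measurable ?P" "\<And>p. 0 \<le> h p" for h :: "_ \<Rightarrow> real"
    unfolding Q_def using that t g
    by (simp add: nn_integral_distr g_def ennreal_mult' ennreal_plus mult.commute)
  have em: "emeasure M B = ennreal (measure M B)" if "M \<in> prob_measures" for M and B :: "'a set"
    using that by (auto simp: prob_measures_def prob_space_def finite_measure.emeasure_eq_measure)
  have ev: "(\<integral>\<^sup>+p. emeasure (fst p) B \<partial>Q) = (\<integral>\<^sup>+p. ennreal (measure (fst p) B) \<partial>Q)"
     "(\<integral>\<^sup>+p. emeasure (snd p) B \<partial>Q) = (\<integral>\<^sup>+p. ennreal (measure (snd p) B) \<partial>Q)" for B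
    using sets_eq_imp_space_eq[OF Q(2)]
    by (auto intro!: nn_integral_cong simp: em space_pair_measure)
  have "ennreal (d \<mu> \<nu>) \<le> (\<integral>\<^sup>+p. ennreal (d (fst p) (snd p)) \<partial>Q)"
  proof (rule conv[unfolded mixture_convex_def, rule_format, OF Q in_P(1,4)])
    fix B :: "'a set" assume B: "B \<in> sets borel"
    note [measurable] = measurable_measure_weak_borel[OF B]
    show "emeasure \<mu> B = (\<integral>\<^sup>+p. emeasure (fst p) B \<partial>Q)"
      unfolding ev by (subst int) (simp_all add: em in_P \<mu> B)
    show "emeasure \<nu> B = (\<integral>\<^sup>+p. emeasure (snd p) B \<partial>Q)"
      unfolding ev by (subst int) (simp_all add: em in_P \<nu> B)
  qed
  also have "\<dots> = ennreal (t * d \<mu>1 \<nu>1 + (1 - t) * d \<mu>2 \<nu>2)"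
    by (subst int) (simp_all add: meas nonneg)
  finally have "ennreal (d \<mu> \<nu>) \<le> ennreal (t * d \<mu>1 \<nu>1 + (1 - t) * d \<mu>2 \<nu>2)" .
  moreover have "0 \<le> t * d \<mu>1 \<nu>1 + (1 - t) * d \<mu>2 \<nu>2"
    using t nonneg by simp
  ultimately show ?thesis
    using ennreal_le_iff by blast
qed

end

theory Submission
  imports Defs
begin

text \<open>
  On the cell \<open>A j\<close> that contains \<open>x\<close>, the measure \<open>averaged_kernel \<gamma> k A x\<close> is the mean of the
  measures \<open>\<pi> y\<close> when \<open>y\<close> is drawn from \<open>chi\<close> conditioned on \<open>A j\<close>: this is the disintegration of
  \<open>\<gamma>\<close> over \<open>A j\<close>, divided by the mass of \<open>A j\<close>. The constant measure \<open>\<pi> x\<close> is its own mean under the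
  same law. Convexity therefore bounds the distance between \<open>\<pi> x\<close> and the averaged kernel by
  the mean of \<open>d (\<pi> x) (\<pi> y)\<close>, and every value of this integrand is at most
  \<open>L * dist x y \<le> L * diameter (A j) \<le> L * \<epsilon>\<close>.

  The mixture is the law of \<open>(\<pi> x, \<pi> y)\<close>, as a measure on pairs of probability measures, so this
  argument requires \<open>\<pi>\<close> to be measurable into \<open>weak_borel\<close>. A kernel is given as a measurable map into
  \<open>prob_algebra borel\<close>, whose \<open>\<sigma>\<close>-algebra is generated by the evaluations \<open>M \<mapsto> M B\<close>. The weak
  topology has a subbasis of sets that are measurable there, but its open sets are arbitrary unions of
  finite intersections of these, and an uncountable union of measurable sets need not be measurable.
  Over a second-countable space, countably many sets suffice for all these unions, because a continuous
  \<open>f \<ge> 0\<close> can be approximated from below by finite suprema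
  of functions \<open>q * indicator B\<close> with \<open>q\<close> rational and \<open>B\<close> basic open: by monotone convergence,
  a lower bound for \<open>\<integral>f dM\<close> is already witnessed by one of these countably many suprema
  (\<open>ex_step_superlevel_below_integral\<close>). This gives \<open>sets_weak_borel_subset_prob_algebra\<close>. The two
  ingredients of the first paragraph are \<open>mixture_convex_le_bound\<close> and
  \<open>averaged_kernel_conditional_mean\<close>.
\<close>

section \<open>Approximation of continuous functions by rational step functions\<close>

text \<open>With values in \<^typ>\<open>ennreal\<close> the supremum over the empty family is 0, and that over an infinite
  family always exists.\<close>

definition step_sup :: "(ennreal \<times> 'a set) set \<Rightarrow> 'a \<Rightarrow> ennreal" where
  "step_sup S x = (SUP (q, B)\<in>S. q * indicator B x)"

lemma step_sup_measurable:
  assumes "countable S" "\<And>q B. (q, B) \<in> S \<Longrightarrow> B \<in> sets M"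
  shows "step_sup S \<in> borel_measurable M"
  unfolding step_sup_def case_prod_beta
  by (intro borel_measurable_SUP borel_measurable_times_ennreal borel_measurable_indicator
      borel_measurable_const assms(1)) (use assms(2) in auto)

lemma step_sup_mono: "S \<subseteq> T \<Longrightarrow> step_sup S \<le> step_sup T"
  unfolding step_sup_def le_fun_def by (auto intro: SUP_subset_mono)

lemma ennreal_rat_between:
  fixes a :: real and b :: ennreal
  assumes "0 \<le> a" "ennreal a < b"
  shows "\<exists>r::rat. a < real_of_rat r \<and> ennreal (real_of_rat r) < b"
proof -
  obtain c where c: "ennreal a < c" "c < b" using dense[OF assms(2)] by blast
  then obtain c' where c': "c = ennreal c'" "0 \<le> c'" by (cases c) auto
  with c assms have "a < c'" by (simp add: ennreal_less_iff)
  then obtain r :: rat where r: "a < of_rat r" "of_rat r < c'"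
    using of_rat_dense by blast
  then have "0 \<le> real_of_rat r" using assms(1) by linarith
  with r(2) have "ennreal (of_rat r) < c"
    by (simp add: c'(1) ennreal_less_iff del: zero_le_of_rat_iff)
  then have "ennreal (of_rat r) < b" using c(2) by (rule less_trans)
  with r(1) show ?thesis by blast
qed

text \<open>This is lower semicontinuity of \<open>f\<close>: if \<open>r < f x\<close>, some basic open set around \<open>x\<close> lies in
  the open set where \<open>f\<close> exceeds \<open>r\<close>, so a single admissible step reaches the height \<open>r\<close> at \<open>x\<close>.
  A negative \<open>r\<close> contributes the zero step.\<close>

lemma continuous_eq_step_sup:
  fixes f :: "'a::topological_space \<Rightarrow> real" and \<B> :: "'a set set"
  assumes base: "topological_basis \<B>"
    and f: "continuous_on UNIV f" "\<And>x. 0 \<le> f x"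
  shows "step_sup {(ennreal (of_rat r), B) | r B. B \<in> \<B> \<and> (\<forall>x\<in>B. of_rat r \<le> f x)} = (\<lambda>x. ennreal (f x))"
    (is "step_sup ?S = _")
proof
  fix x
  show "step_sup ?S x = ennreal (f x)"
  proof (rule antisym)
    show "step_sup ?S x \<le> ennreal (f x)"
      unfolding step_sup_def by (rule SUP_least) (auto intro!: ennreal_leI split: split_indicator)
    show "ennreal (f x) \<le> step_sup ?S x"
    proof (rule dense_le)
      fix a assume a: "a < ennreal (f x)"
      then obtain a' where a': "a = ennreal a'" "0 \<le> a'" by (cases a) auto
      obtain r :: rat where r: "a' < of_rat r" "ennreal (of_rat r) < ennreal (f x)"
        using ennreal_rat_between[of a' "ennreal (f x)"] a a' by auto
      then have "of_rat r < f x"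
        using a'(2) ennreal_less_iff[of "of_rat r" "f x"] by linarith
      moreover have "open {y. of_rat r < f y}"
        by (rule open_Collect_less[OF continuous_on_const f(1)])
      ultimately obtain B where B: "B \<in> \<B>" "x \<in> B" "B \<subseteq> {y. of_rat r < f y}"
        using topological_basisE[OF base] by (metis mem_Collect_eq)
      have "a \<le> ennreal (of_rat r) * indicator B x"
        using r a' B by (simp add: ennreal_leI)
      also have "\<dots> \<le> step_sup ?S x"
        unfolding step_sup_def
        by (rule SUP_upper2[of "(ennreal (of_rat r), B)"]) (use B in \<open>auto intro: less_imp_le\<close>)
      finally show "a \<le> step_sup ?S x" .
    qed
  qed
qed

text \<open>The suprema over the initial segments of an enumeration of \<open>S\<close> increase to the supremum over
  \<open>S\<close>, so monotone convergence applies.\<close>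

lemma nn_integral_step_sup_finite:
  assumes S: "countable S" "\<And>q B. (q, B) \<in> S \<Longrightarrow> B \<in> sets M"
    and a: "a < (\<integral>\<^sup>+x. step_sup S x \<partial>M)"
  shows "\<exists>F\<subseteq>S. finite F \<and> a < (\<integral>\<^sup>+x. step_sup F x \<partial>M)"
proof (cases "S = {}")
  case True
  with a show ?thesis by blast
next
  case False
  define F where "F n = from_nat_into S ` {..n}" for n :: nat
  have F: "finite (F n)" "F n \<subseteq> S" for n
    using from_nat_into[OF False] by (auto simp: F_def)
  have S_eq: "S = (\<Union>n. F n)"
    unfolding F_def image_UN[symmetric] using range_from_nat_into[OF False S(1)]
    by (simp add: UN_atMost_UNIV)
  have "step_sup S x = (SUP n. step_sup (F n) x)" for x
    unfolding step_sup_def by (subst S_eq) (rule SUP_UNION)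
  then have "(\<integral>\<^sup>+x. step_sup S x \<partial>M) = (\<integral>\<^sup>+x. (SUP n. step_sup (F n) x) \<partial>M)"
    by simp
  also have "\<dots> = (SUP n. \<integral>\<^sup>+x. step_sup (F n) x \<partial>M)"
  proof (rule nn_integral_monotone_convergence_SUP)
    show "incseq (\<lambda>n. step_sup (F n))"
      unfolding incseq_def by (auto intro!: step_sup_mono simp: F_def)
    show "step_sup (F n) \<in> borel_measurable M" for n
      using F(2)[of n] S(2) by (intro step_sup_measurable countable_finite F(1)) blast
  qed
  finally obtain n where "a < (\<integral>\<^sup>+x. step_sup (F n) x \<partial>M)"
    using a by (auto simp: less_SUP_iff)
  with F show ?thesis by blast
qed

section \<open>Countably many sets suffice for the weak topology\<close>

text \<open>These sets play the role of a countable subbasis: they are measurable, and around each point of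
  a weakly open set, finitely many of them have their intersection inside that set.\<close>

definition step_superlevels :: "'a::topological_space set set \<Rightarrow> 'a measure set set" where
  "step_superlevels \<B> = (\<lambda>(r, F). {M \<in> prob_measures.
      ennreal (real_of_rat r) < (\<integral>\<^sup>+x. step_sup F x \<partial>M)}) `
     (UNIV \<times> {F. finite F \<and> F \<subseteq> range (ennreal \<circ> real_of_rat) \<times> \<B>})"

lemma countable_step_superlevels:
  assumes "countable \<B>"
  shows "countable (step_superlevels \<B>)"
  unfolding step_superlevels_def
  by (intro countable_image countable_SIGMA countable_Collect_finite_subset assms) auto

lemma space_prob_algebra_borel: "space (prob_algebra borel) = prob_measures"
  by (auto simp: space_prob_algebra prob_measures_def)

lemma step_superlevels_sets:
  fixes \<B> :: "'a::topological_space set set"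
  assumes "\<B> \<subseteq> sets borel" "V \<in> step_superlevels \<B>"
  shows "V \<in> sets (prob_algebra borel)"
proof -
  obtain r F where F: "finite F" "F \<subseteq> range (ennreal \<circ> real_of_rat) \<times> \<B>"
    and V: "V = {M \<in> prob_measures. ennreal (real_of_rat r) < (\<integral>\<^sup>+x. step_sup F x \<partial>M)}"
    using assms(2) by (auto simp: step_superlevels_def)
  have [measurable]: "step_sup F \<in> borel_measurable borel"
    using F assms(1) by (intro step_sup_measurable) (auto intro: countable_finite)
  have [measurable]: "(\<lambda>M. \<integral>\<^sup>+x. step_sup F x \<partial>M) \<in> borel_measurable (prob_algebra borel)"
    unfolding prob_algebra_def
    by (intro measurable_restrict_space1 nn_integral_measurable_subprob_algebra) measurable
  show ?thesis
    unfolding V space_prob_algebra_borel[symmetric] by measurable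
qed

text \<open>A constant \<open>c\<close> is added so that \<open>f + c\<close> and the threshold \<open>a + c\<close> are nonnegative; for
  probability measures this shifts the integral by exactly \<open>c\<close>. As \<open>f + c\<close> is a supremum of countably
  many rational steps, finitely many of them have a supremum whose integral exceeds a rational number
  above \<open>a + c\<close> at \<open>N\<close>, and wherever this happens \<open>\<integral>f\<close> exceeds \<open>a\<close>.\<close>

lemma ex_step_superlevel_below_integral:
  fixes f :: "'a::topological_space \<Rightarrow> real"
  assumes base: "topological_basis \<B>" "countable \<B>"
    and f: "continuous_on UNIV f" "bounded (range f)"
    and N: "N \<in> prob_measures" "a < (\<integral>x. f x \<partial>N)"
  shows "\<exists>V\<in>step_superlevels \<B>. N \<in> V \<and> (\<forall>M\<in>V. a < (\<integral>x. f x \<partial>M))"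
proof -
  obtain c0 where c0: "\<And>x. \<bar>f x\<bar> \<le> c0"
    using f(2) by (auto simp: bounded_iff)
  define c where "c = max c0 \<bar>a\<bar>"
  have c: "\<bar>f x\<bar> \<le> c" "0 \<le> a + c" for x
    using c0[of x] by (auto simp: c_def)
  have shift: "(\<integral>\<^sup>+x. ennreal (f x + c) \<partial>M) = ennreal ((\<integral>x. f x \<partial>M) + c)"
    if M: "M \<in> prob_measures" for M
  proof -
    interpret prob_space M using M by (simp add: prob_measures_def)
    have "f \<in> borel_measurable M"
      using M borel_measurable_continuous_onI[OF f(1)] measurable_cong_sets[of M borel]
      by (auto simp: prob_measures_def)
    then have int: "integrable M f"
      using c(1) by (intro integrable_const_bound[of _ c]) auto
    have "0 \<le> f x + c" for x using c(1)[of x] by auto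
    with int show ?thesis
      by (subst nn_integral_eq_integral) (auto simp: prob_space)
  qed
  define S where "S = {(ennreal (of_rat r), B) | r B. B \<in> \<B> \<and> (\<forall>x\<in>B. of_rat r \<le> f x + c)}"
  have S_sub: "S \<subseteq> range (ennreal \<circ> real_of_rat) \<times> \<B>"
    by (auto simp: S_def)
  then have S: "countable S"
    by (rule countable_subset) (intro countable_SIGMA base; simp)
  have S_eq: "step_sup S = (\<lambda>x. ennreal (f x + c))"
    unfolding S_def using c(1)
    by (intro continuous_eq_step_sup base continuous_intros f) (smt (verit))
  obtain r where r: "a + c < real_of_rat r" "ennreal (of_rat r) < (\<integral>\<^sup>+x. step_sup S x \<partial>N)"
    using ennreal_rat_between[of "a + c" "\<integral>\<^sup>+x. step_sup S x \<partial>N"] c(2) N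
    by (auto simp: S_eq shift ennreal_less_iff)
  have "B \<in> sets N" if "(q, B) \<in> S" for q B
    using that S_sub topological_basis_open[OF base(1)] N(1) by (auto simp: prob_measures_def)
  then obtain F where F: "F \<subseteq> S" "finite F" "ennreal (of_rat r) < (\<integral>\<^sup>+x. step_sup F x \<partial>N)"
    using nn_integral_step_sup_finite[OF S _ r(2)] by blast
  let ?V = "{M \<in> prob_measures. ennreal (real_of_rat r) < (\<integral>\<^sup>+x. step_sup F x \<partial>M)}"
  have "?V \<in> step_superlevels \<B>"
    unfolding step_superlevels_def using F S_sub by (intro image_eqI[of _ _ "(r, F)"]) auto
  moreover have "a < (\<integral>x. f x \<partial>M)" if M: "M \<in> ?V" for M
  proof -
    have "ennreal (of_rat r) < (\<integral>\<^sup>+x. step_sup F x \<partial>M)" using M by simp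
    also have "\<dots> \<le> (\<integral>\<^sup>+x. step_sup S x \<partial>M)"
      using step_sup_mono[OF F(1)] by (intro nn_integral_mono) (auto simp: le_fun_def)
    also have "\<dots> = ennreal ((\<integral>x. f x \<partial>M) + c)"
      using M by (simp add: S_eq shift)
    finally have less: "ennreal (of_rat r) < ennreal ((\<integral>x. f x \<partial>M) + c)" .
    have "0 \<le> real_of_rat r" using r(1) c(2) by linarith
    with less have "of_rat r < (\<integral>x. f x \<partial>M) + c"
      using ennreal_less_iff by blast
    with r(1) show ?thesis by linarith
  qed
  ultimately show ?thesis using F N(1) by (intro bexI[of _ ?V]) auto
qed

text \<open>Finite intersections of the sets above form a countable family \<open>\<C>\<close> of measurable sets that
  contains, for each point of a weakly open set \<open>U\<close>, a member around this point inside \<open>U\<close>. Hence a weakly open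
  set is a countable union of members of \<open>\<C>\<close>.\<close>

lemma sets_weak_borel_subset_prob_algebra:
  "sets (weak_borel :: 'a::second_countable_topology measure measure) \<subseteq> sets (prob_algebra borel)"
proof -
  obtain \<B> :: "'a set set" where base: "countable \<B>" "topological_basis \<B>"
    using ex_countable_basis by blast
  define \<C> where "\<C> = (\<lambda>\<F>. prob_measures \<inter> \<Inter>\<F>) ` {\<F>. finite \<F> \<and> \<F> \<subseteq> step_superlevels \<B>}"
  have countable_C: "countable \<C>"
    unfolding \<C>_def
    by (intro countable_image countable_Collect_finite_subset countable_step_superlevels base)
  have Int_C: "V \<inter> W \<in> \<C>" if VW: "V \<in> \<C>" "W \<in> \<C>" for V W
  proof -
    obtain \<F> \<G> where "finite \<F>" "\<F> \<subseteq> step_superlevels \<B>" "V = prob_measures \<inter> \<Inter>\<F>"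
      "finite \<G>" "\<G> \<subseteq> step_superlevels \<B>" "W = prob_measures \<inter> \<Inter>\<G>"
      using VW by (auto simp: \<C>_def)
    then show ?thesis
      unfolding \<C>_def by (intro image_eqI[of _ _ "\<F> \<union> \<G>"]) auto
  qed
  have sets_C: "V \<in> sets (prob_algebra borel)" if V: "V \<in> \<C>" for V
  proof -
    obtain \<F> where "finite \<F>" "\<F> \<subseteq> step_superlevels \<B>" "V = prob_measures \<inter> \<Inter>\<F>"
      using V by (auto simp: \<C>_def)
    moreover have "\<B> \<subseteq> sets borel"
      using topological_basis_open[OF base(2)] by auto
    ultimately have "V = space (prob_algebra borel) \<inter> \<Inter>\<F>"
        "\<And>W. W \<in> \<F> \<Longrightarrow> W \<in> sets (prob_algebra borel)" "finite \<F>"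
      using step_superlevels_sets by (auto simp: space_prob_algebra_borel)
    then show ?thesis
      using sets.finite_INT[of \<F> "\<lambda>W. W" "prob_algebra borel"]
      by (cases "\<F> = {}") (simp_all add: sets.Int)
  qed
  have local_base: "\<forall>N\<in>U. \<exists>V\<in>\<C>. N \<in> V \<and> V \<subseteq> U" if U: "openin weak_topology U" for U
  proof -
    have "generate_topology_on {{M \<in> prob_measures. (\<integral>x. f x \<partial>M) \<in> U} | (f :: 'a \<Rightarrow> real) U.
        continuous_on UNIV f \<and> bounded (range f) \<and> open U} U"
      using U by (simp add: weak_topology_def openin_topology_generated_by_iff)
    then show ?thesis
    proof induction
      case Empty
      show ?case by simp
    next
      case (Int U V)
      show ?case
      proof
        fix N assume "N \<in> U \<inter> V"
        then obtain U' V' where "U' \<in> \<C>" "V' \<in> \<C>" "N \<in> U' \<inter> V'" "U' \<subseteq> U" "V' \<subseteq> V"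
          using Int.IH by blast
        then show "\<exists>W\<in>\<C>. N \<in> W \<and> W \<subseteq> U \<inter> V"
          using Int_C by (intro bexI[of _ "U' \<inter> V'"]) auto
      qed
    next
      case (UN K)
      then show ?case by (meson Sup_upper Union_iff subset_trans)
    next
      case (Basis s)
      then obtain f :: "'a \<Rightarrow> real" and U where f: "continuous_on UNIV f" "bounded (range f)"
        and U: "open U" and s: "s = {M \<in> prob_measures. (\<integral>x. f x \<partial>M) \<in> U}"
        by blast
      show ?case
      proof
        fix N assume "N \<in> s"
        then have N: "N \<in> prob_measures" "(\<integral>x. f x \<partial>N) \<in> U" by (auto simp: s)
        then obtain e where e: "0 < e" "ball (\<integral>x. f x \<partial>N) e \<subseteq> U"
          using U open_contains_ball by blast
        have neg: "continuous_on UNIV (\<lambda>x. - f x)" "bounded (range (\<lambda>x. - f x))"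
          using f by (auto intro: continuous_intros simp: bounded_iff)
        obtain V where V: "V \<in> step_superlevels \<B>" "N \<in> V"
            "\<And>M. M \<in> V \<Longrightarrow> (\<integral>x. f x \<partial>N) - e < (\<integral>x. f x \<partial>M)"
          using ex_step_superlevel_below_integral[OF base(2,1) f N(1), of "(\<integral>x. f x \<partial>N) - e"] e by auto
        \<comment> \<open>Upper bounds for the integral of \<open>f\<close> are lower bounds for that of \<open>- f\<close>.\<close>
        obtain W where W: "W \<in> step_superlevels \<B>" "N \<in> W"
            "\<And>M. M \<in> W \<Longrightarrow> (\<integral>x. f x \<partial>M) < (\<integral>x. f x \<partial>N) + e"
          using ex_step_superlevel_below_integral[OF base(2,1) neg N(1), of "- (\<integral>x. f x \<partial>N) - e"] e
          by auto fastforce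
        have "prob_measures \<inter> \<Inter>{V, W} \<in> \<C>"
          unfolding \<C>_def using V(1) W(1) by (intro imageI) auto
        moreover have "prob_measures \<inter> \<Inter>{V, W} \<subseteq> s"
        proof
          fix M assume "M \<in> prob_measures \<inter> \<Inter>{V, W}"
          then have M: "M \<in> prob_measures" "M \<in> V" "M \<in> W" by auto
          have "(\<integral>x. f x \<partial>M) \<in> ball (\<integral>x. f x \<partial>N) e"
            using V(3)[OF M(2)] W(3)[OF M(3)] by (simp add: dist_real_def)
          with M(1) e(2) show "M \<in> s" by (auto simp: s)
        qed
        ultimately show "\<exists>V\<in>\<C>. N \<in> V \<and> V \<subseteq> s"
          using V(2) W(2) N(1) by (intro bexI[of _ "prob_measures \<inter> \<Inter>{V, W}"] conjI) simp_all
      qed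
    qed
  qed
  have "U \<in> sets (prob_algebra borel)" if U: "openin weak_topology U" for U :: "'a measure set"
  proof -
    have "U = \<Union>{V \<in> \<C>. V \<subseteq> U}" using local_base[OF U] by blast
    moreover have "countable {V \<in> \<C>. V \<subseteq> U}"
      by (rule countable_subset[OF _ countable_C]) blast
    then have "\<Union>{V \<in> \<C>. V \<subseteq> U} \<in> sets (prob_algebra borel)"
      using sets_C by (intro sets.countable_Union) auto
    ultimately show ?thesis by (rule ssubst)
  qed
  then have "sigma_sets (space (prob_algebra borel)) {U. openin (weak_topology :: 'a measure topology) U}
      \<subseteq> sets (prob_algebra borel)"
    by (intro sets.sigma_sets_subset) auto
  then show ?thesis
    unfolding weak_borel_def sets_measure_of[OF weak_borel_openin] space_prob_algebra_borel .
qed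

lemma measurable_prob_algebra_imp_weak_borel:
  fixes \<kappa> :: "'x \<Rightarrow> 'a::second_countable_topology measure"
  assumes "\<kappa> \<in> M \<rightarrow>\<^sub>M prob_algebra borel"
  shows "\<kappa> \<in> M \<rightarrow>\<^sub>M weak_borel"
proof -
  have "(\<lambda>N. N) \<in> prob_algebra (borel :: 'a measure) \<rightarrow>\<^sub>M weak_borel"
    using sets_weak_borel_subset_prob_algebra
    by (intro measurableI) (auto simp: space_prob_algebra_borel sets.Int_space_eq2)
  from measurable_compose[OF assms this] show ?thesis .
qed

section \<open>Convexity along a kernel\<close>

text \<open>The mixture is the law of \<open>(\<mu>, \<kappa> y)\<close> for \<open>y\<close> drawn from \<open>N\<close>. Its barycentre is \<open>(\<mu>, \<nu>)\<close>, and the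
  mean of \<open>d\<close> under it is at most \<open>c\<close>.\<close>

lemma mixture_convex_le_bound:
  fixes d :: "'a::{second_countable_topology, metric_space} measure \<Rightarrow> 'a measure \<Rightarrow> real"
  assumes conv: "mixture_convex d"
    and meas: "(\<lambda>p. d (fst p) (snd p)) \<in> borel_measurable (weak_borel \<Otimes>\<^sub>M weak_borel)"
    and N: "prob_space N"
    and \<kappa>: "\<kappa> \<in> N \<rightarrow>\<^sub>M prob_algebra borel"
    and \<mu>: "\<mu> \<in> prob_measures" and \<nu>: "\<nu> \<in> prob_measures"
    and bary: "\<And>B. B \<in> sets borel \<Longrightarrow> emeasure \<nu> B = (\<integral>\<^sup>+y. emeasure (\<kappa> y) B \<partial>N)"
    and bound: "AE y in N. d \<mu> (\<kappa> y) \<le> c" and c: "0 \<le> c"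
  shows "d \<mu> \<nu> \<le> c"
proof -
  interpret N: prob_space N by fact
  let ?P = "weak_borel \<Otimes>\<^sub>M weak_borel :: ('a measure \<times> 'a measure) measure"
  have g [measurable]: "(\<lambda>y. (\<mu>, \<kappa> y)) \<in> N \<rightarrow>\<^sub>M ?P"
    using measurable_prob_algebra_imp_weak_borel[OF \<kappa>] \<mu> by (intro measurable_Pair) auto
  define Q where "Q = distr N ?P (\<lambda>y. (\<mu>, \<kappa> y))"
  have Q: "prob_space Q" "sets Q = sets ?P"
    unfolding Q_def using N.prob_space_distr[OF g] by auto
  have ev: "(\<lambda>M. emeasure M B) \<in> borel_measurable weak_borel" if "B \<in> sets borel" for B :: "'a set"
  proof -
    have "(\<lambda>M. ennreal (measure M B)) \<in> borel_measurable weak_borel"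
      using measurable_measure_weak_borel[OF that] by measurable
    moreover have "ennreal (measure M B) = emeasure M B" if "M \<in> space weak_borel" for M
      using that
      by (auto simp: prob_measures_def prob_space_def finite_measure.emeasure_eq_measure)
    ultimately show ?thesis
      using measurable_cong[of weak_borel "\<lambda>M. ennreal (measure M B)" "\<lambda>M. emeasure M B"] by blast
  qed
  have "ennreal (d \<mu> \<nu>) \<le> (\<integral>\<^sup>+p. ennreal (d (fst p) (snd p)) \<partial>Q)"
  proof (rule conv[unfolded mixture_convex_def, rule_format, OF Q \<mu> \<nu>])
    fix B :: "'a set" assume B: "B \<in> sets borel"
    note [measurable] = ev[OF B]
    show "emeasure \<mu> B = (\<integral>\<^sup>+p. emeasure (fst p) B \<partial>Q)"
      unfolding Q_def by (subst nn_integral_distr) (simp_all add: N.emeasure_space_1)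
    show "emeasure \<nu> B = (\<integral>\<^sup>+p. emeasure (snd p) B \<partial>Q)"
      unfolding Q_def by (subst nn_integral_distr) (simp_all add: bary[OF B])
  qed
  also have "\<dots> = (\<integral>\<^sup>+y. ennreal (d \<mu> (\<kappa> y)) \<partial>N)"
    unfolding Q_def using meas by (subst nn_integral_distr) simp_all
  also have "\<dots> \<le> (\<integral>\<^sup>+y. ennreal c \<partial>N)"
    using bound by (intro nn_integral_mono_AE) (auto elim!: eventually_mono intro: ennreal_leI)
  also have "\<dots> = ennreal c"
    by (simp add: N.emeasure_space_1)
  finally show ?thesis using c by simp
qed

section \<open>The averaged kernel as a conditional mean\<close>

lemma bounded_of_totally_bounded:
  fixes S :: "'a::metric_space set"
  assumes "totally_bounded S"
  shows "bounded S"
proof -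
  obtain K where "finite K" "S \<subseteq> (\<Union>x\<in>K. ball x 1)"
    using assms[unfolded totally_bounded_metric, rule_format, of 1] by (auto simp: ball_def)
  then show ?thesis
    by (meson bounded_UN bounded_ball bounded_subset)
qed

text \<open>The averaged kernel is given by a set function to \<^const>\<open>measure_of\<close>, which returns a measure
  with those values only if the function is countably additive. Additivity holds because the function is
  the second marginal of \<open>\<gamma>\<close> conditioned on \<open>A j \<times> UNIV\<close>: by disjointness, only the summand of
  the cell containing \<open>x\<close> survives.\<close>

lemma averaged_kernel_conditional_mean:
  fixes \<gamma> :: "('x::topological_space \<times> 'b::topological_space) measure"
  assumes \<gamma>: "prob_space \<gamma>" "sets \<gamma> = sets (borel \<Otimes>\<^sub>M borel)"
    and A: "\<And>j. j \<in> {1..k} \<Longrightarrow> A j \<in> sets borel" "disjoint_family_on A {1..k}"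
    and j: "j \<in> {1..k}" "x \<in> A j" "measure (first_marginal \<gamma>) (A j) > 0"
  shows "averaged_kernel \<gamma> k A x \<in> prob_measures" (is ?prob)
    and "\<And>B. B \<in> sets borel \<Longrightarrow> emeasure (averaged_kernel \<gamma> k A x) B
           = ennreal (measure \<gamma> (A j \<times> B) / measure (first_marginal \<gamma>) (A j))" (is "\<And>B. _ \<Longrightarrow> ?val B")
proof -
  interpret prob_space \<gamma> by fact
  have space_\<gamma>: "space \<gamma> = UNIV"
    using sets_eq_imp_space_eq[OF \<gamma>(2)] by (simp add: space_pair_measure)
  have [measurable]: "fst \<in> \<gamma> \<rightarrow>\<^sub>M borel" "snd \<in> \<gamma> \<rightarrow>\<^sub>M borel"
    using measurable_cong_sets[OF \<gamma>(2) refl] by auto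
  have Aj: "A j \<times> B \<in> sets \<gamma>" if "B \<in> sets borel" for B
    using A(1)[OF j(1)] that by (simp add: \<gamma>(2))
  have marg: "measure (first_marginal \<gamma>) (A j) = measure \<gamma> (A j \<times> UNIV)"
    unfolding first_marginal_def using A(1)[OF j(1)]
    by (subst measure_distr) (auto simp: space_\<gamma> intro!: arg_cong[of _ _ "measure \<gamma>"])
  with j(3) have pos: "0 < measure \<gamma> (A j \<times> UNIV)" by simp
  define N where "N = distr (uniform_measure \<gamma> (A j \<times> UNIV)) borel snd"
  have "prob_space (uniform_measure \<gamma> (A j \<times> UNIV))"
    using pos by (intro prob_space_uniform_measure) (auto simp: emeasure_eq_measure)
  then have N: "prob_space N" "sets N = sets borel"
    unfolding N_def by (auto intro!: prob_space.prob_space_distr)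
  have emN: "emeasure N B = ennreal (measure \<gamma> (A j \<times> B) / measure (first_marginal \<gamma>) (A j))"
    if B: "B \<in> sets borel" for B
  proof -
    have "(A j \<times> UNIV) \<inter> (snd -` B \<inter> space \<gamma>) = A j \<times> B" by (auto simp: space_\<gamma>)
    moreover have "snd -` B \<inter> space \<gamma> \<in> sets \<gamma>"
      using B by measurable
    ultimately show ?thesis
      unfolding N_def using B Aj pos
      by (subst emeasure_distr) (auto simp: marg emeasure_eq_measure divide_ennreal)
  qed
  have "averaged_kernel \<gamma> k A x = measure_of UNIV (sets borel) (emeasure N)"
    unfolding averaged_kernel_def
  proof (rule measure_of_eq)
    fix B :: "'b set" assume "B \<in> sigma_sets UNIV (sets borel)"
    then have B: "B \<in> sets borel"
      using sets.sigma_sets_eq[of "borel :: 'b measure"] by simp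
    have "indicator (A i) x = (if i = j then 1 else 0 :: real)" if "i \<in> {1..k}" for i
      using disjoint_family_onD[OF A(2) j(1) that] j(2) by (auto split: split_indicator)
    then have "(\<Sum>i=1..k. measure \<gamma> (A i \<times> B) / measure (first_marginal \<gamma>) (A i) * indicator (A i) x)
        = (\<Sum>i=1..k. if i = j then measure \<gamma> (A i \<times> B) / measure (first_marginal \<gamma>) (A i) else 0)"
      by (intro sum.cong) auto
    also have "\<dots> = measure \<gamma> (A j \<times> B) / measure (first_marginal \<gamma>) (A j)"
      using j(1) by simp
    finally show "ennreal (\<Sum>i=1..k. measure \<gamma> (A i \<times> B) / measure (first_marginal \<gamma>) (A i)
        * indicator (A i) x) = emeasure N B"
      by (simp add: emN[OF B])
  qed simp
  also have "\<dots> = N"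
    using measure_of_of_measure[of N] N(2) sets_eq_imp_space_eq[OF N(2)] by simp
  finally have eq: "averaged_kernel \<gamma> k A x = N" .
  show ?prob using N by (simp add: eq prob_measures_def)
  show "?val B" if "B \<in> sets borel" for B using emN[OF that] by (simp add: eq)
qed

section \<open>The error bound\<close>

theorem proposition3p2:
  fixes \<gamma> :: "('x::metric_space \<times> (real ^ 'd)) measure"
    and chi :: "'x measure"
    and \<pi> :: "'x \<Rightarrow> (real ^ 'd) measure"
    and \<epsilon> L :: real
    and k :: nat
    and A :: "nat \<Rightarrow> 'x set"
    and d :: "(real ^ 'd) measure \<Rightarrow> (real ^ 'd) measure \<Rightarrow> real"
  assumes X: "totally_bounded (UNIV :: 'x set)"
    and \<gamma>: "prob_space \<gamma>" "sets \<gamma> = sets (borel \<Otimes>\<^sub>M borel)"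
    and chi_def: "chi = first_marginal \<gamma>"
    and supp: "measure_support chi = UNIV"
    and kernel: "\<pi> \<in> borel \<rightarrow>\<^sub>M prob_algebra borel"
    and disint: "\<And>C B. C \<in> sets borel \<Longrightarrow> B \<in> sets borel \<Longrightarrow>
        (LINT x:C|chi. measure (\<pi> x) B) = measure \<gamma> (C \<times> B)"
    and \<epsilon>: "\<epsilon> > 0"
    and A_sets: "\<And>j. j \<in> {1..k} \<Longrightarrow> A j \<in> sets borel"
    and A_disj: "disjoint_family_on A {1..k}"
    and A_cover: "(\<Union>j\<in>{1..k}. A j) = UNIV"
    and A_pos: "\<And>j. j \<in> {1..k} \<Longrightarrow> measure chi (A j) > 0"
    and A_bd: "\<And>j. j \<in> {1..k} \<Longrightarrow> measure chi (frontier (A j)) = 0"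
    and A_diam: "\<And>j. j \<in> {1..k} \<Longrightarrow> diameter (A j) \<le> \<epsilon>"
    and d_dist: "Metric_space prob_measures d"
    and d_convex: "mixture_convex d"
    and d_meas: "(\<lambda>p. d (fst p) (snd p)) \<in> borel_measurable (weak_borel \<Otimes>\<^sub>M weak_borel)"
    and L: "L \<ge> 0"
    and Lip: "\<And>x1 x2. d (\<pi> x1) (\<pi> x2) \<le> L * dist x1 x2"
  shows "\<forall>x. d (\<pi> x) (averaged_kernel \<gamma> k A x) \<le> L * \<epsilon>"
proof
  fix x
  interpret \<gamma>: prob_space \<gamma> by fact
  have "fst \<in> \<gamma> \<rightarrow>\<^sub>M (borel :: 'x measure)"
    using measurable_cong_sets[OF \<gamma>(2) refl] by auto
  then have chi: "prob_space chi" "sets chi = sets borel"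
    by (auto simp: chi_def first_marginal_def intro: \<gamma>.prob_space_distr)
  interpret chi: prob_space chi by fact
  have \<pi>: "\<pi> y \<in> prob_measures" for y
    using measurable_space[OF kernel, of y] by (simp add: space_prob_algebra_borel)
  obtain j where j: "j \<in> {1..k}" "x \<in> A j" using A_cover by blast
  note pos = A_pos[OF j(1)]
  have Aj: "A j \<in> sets chi" using A_sets[OF j(1)] chi(2) by simp
  have emA: "emeasure chi (A j) = ennreal (measure chi (A j))"
    by (rule chi.emeasure_eq_measure)
  let ?N = "uniform_measure chi (A j)"
  note avg = averaged_kernel_conditional_mean[OF \<gamma> A_sets A_disj j pos[unfolded chi_def]]
  show "d (\<pi> x) (averaged_kernel \<gamma> k A x) \<le> L * \<epsilon>"
  proof (rule mixture_convex_le_bound[OF d_convex d_meas, of ?N \<pi>])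
    show "prob_space ?N"
      using pos by (intro prob_space_uniform_measure) (auto simp: emA)
    show "\<pi> \<in> ?N \<rightarrow>\<^sub>M prob_algebra borel"
      using kernel measurable_cong_sets[of ?N borel] chi(2) by auto
    show "averaged_kernel \<gamma> k A x \<in> prob_measures"
      by (rule avg(1)) simp
    fix B :: "(real ^ 'd) set" assume B: "B \<in> sets borel"
    have em: "emeasure (\<pi> y) B = ennreal (measure (\<pi> y) B)" for y
      using \<pi>[of y] by (simp add: prob_measures_def prob_space_def finite_measure.emeasure_eq_measure)
    have meas: "(\<lambda>y. measure (\<pi> y) B) \<in> borel_measurable chi"
      using measurable_compose[OF measurable_prob_algebra_imp_weak_borel[OF kernel]
          measurable_measure_weak_borel[OF B]] measurable_cong_sets[OF chi(2) refl] by auto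
    have le1: "measure (\<pi> y) B \<le> 1" for y
      using \<pi>[of y] by (simp add: prob_measures_def prob_space.prob_le_1)
    have int: "integrable chi (\<lambda>y. indicator (A j) y * measure (\<pi> y) B)"
      using meas Aj le1 by (intro chi.integrable_const_bound[of _ 1]) (auto split: split_indicator)
    \<comment> \<open>The conditional mean of \<open>\<pi> y B\<close> over \<open>A j\<close> is computed by disintegrating \<open>\<gamma>\<close>.\<close>
    have "(\<integral>\<^sup>+y. emeasure (\<pi> y) B \<partial>?N)
        = (\<integral>\<^sup>+y. emeasure (\<pi> y) B * indicator (A j) y \<partial>chi) / emeasure chi (A j)"
      using meas Aj by (intro nn_integral_uniform_measure) (auto simp: em)
    also have "(\<integral>\<^sup>+y. emeasure (\<pi> y) B * indicator (A j) y \<partial>chi)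
        = (\<integral>\<^sup>+y. ennreal (indicator (A j) y * measure (\<pi> y) B) \<partial>chi)"
      by (intro nn_integral_cong) (auto simp: em split: split_indicator)
    also have "\<dots> = ennreal (LINT y:A j|chi. measure (\<pi> y) B)"
      using int by (subst nn_integral_eq_integral) (auto simp: set_lebesgue_integral_def)
    also have "\<dots> = ennreal (measure \<gamma> (A j \<times> B))"
      by (simp add: disint A_sets[OF j(1)] B)
    also have "\<dots> / emeasure chi (A j) = emeasure (averaged_kernel \<gamma> k A x) B"
      using pos avg(2)[OF _ B] by (simp add: emA divide_ennreal chi_def[symmetric])
    finally show "emeasure (averaged_kernel \<gamma> k A x) B = (\<integral>\<^sup>+y. emeasure (\<pi> y) B \<partial>?N)" ..
  next
    have "d (\<pi> x) (\<pi> y) \<le> L * \<epsilon>" if y: "y \<in> A j" for y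
    proof -
      \<comment> \<open>\<open>diameter\<close> is a real supremum, which is unspecified on unbounded sets.\<close>
      have "bounded (A j)"
        using bounded_of_totally_bounded[OF X] bounded_subset by blast
      then have "dist x y \<le> \<epsilon>"
        using diameter_bounded_bound[of "A j" x y] j(2) y A_diam[OF j(1)] by linarith
      with Lip[of x y] L show ?thesis
        by (meson mult_left_mono order_trans)
    qed
    then show "AE y in ?N. d (\<pi> x) (\<pi> y) \<le> L * \<epsilon>"
      using Aj by (intro AE_uniform_measureI) auto
  qed (use \<pi> L \<epsilon> in auto)
qed

end
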